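(* Let $f$ be a scalar-valued continuously differentiable function defined on $\mathcal F=\{x\in\mathbb R^n : \ell\le x\le u\}$. Assume that $x_0\in\mathcal F$ is chosen such that the level set $\mathcal L(f(x_0))=\{x\in\mathcal F: f(x)\le f(x_0)\}$ is bounded, and that $\{x_k\}_{k\ge0}$ is given by $x_{k+1}=x_k(\alpha_k)$ with $x_k(\alpha)=P_{\mathcal F}(x_k+\alpha p_k)$, where either every $\alpha_k$ is a quasi-Armijo step, or every $\alpha_k$ is a quasi-Wolfe step for $\varphi_k(\alpha)=f(x_k(\alpha))$, $\alpha\ge0$. For an arbitrarily fixed $\epsilon>0$, define $\epsilon_0=\epsilon$ and $\epsilon_k=\min\{\epsilon,\ \|\Pi_{k-1}^T\nabla f(x_{k-1})\|\}$ for $k\ge1$, where each $\Pi_k$ is a matrix with orthonormal columns whose columns span the set of projected directions $\{d\in\mathbb R^n : d_i=0\text{ for all } i\in\mathcal W_k\}$ with respect to the working set $\mathcal W_k$. Suppose that $\{p_k\}$ is a sequence of descent directions (i.e. $\nabla f(x_k)^Tp_k<0$ for all $k$) with $\|p_k\|\le\theta$ for some constant $\theta$ independent of $k$, that $\Pi_k\Pi_k^Tp_k=p_k$ for all $k$, and that $[p_k]_i\ge0$ if $[x_k]_i\le\ell_i+\epsilon_k$, and $[p_k]_i\le0$ if $[x_k]_i\ge u_i-\epsilon_k$. Assume in addition that $\{x_k\}$ converges to a nondegenerate stationary point $x^*$ of the problem of minimizing $f$ over $\mathcal F$. Consider the extended active set $$\mathcal A_{\epsilon_k}(x_k)=\{i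 : [x_k]_i\le\ell_i+\epsilon_k\ \text{or}\ [x_k]_i\ge u_i-\epsilon_k\}.$$ If $\|\Pi_k^T\nabla f(x_k)\|\to0$, then $\mathcal A_{\epsilon_k}(x_k)=\mathcal A(x_k)=\mathcal A(x^* )$ for all $k$ sufficiently large.
   Context: Here $\ell\le u$ are vectors of lower and upper bounds (inequalities componentwise; components of $\ell$ may be $-\infty$ and components of $u$ may be $+\infty$), $f$ being continuously differentiable on $\mathcal F$ means $f$ is $C^1$ on an open set containing $\mathcal F$, and $\|\cdot\|$ is the Euclidean norm. $[v]_i$ denotes the $i$th component of $v$, and $\nabla_i f$ the $i$th component of $\nabla f$. $P_{\mathcal F}$ is the componentwise projection onto $\mathcal F$: $[P_{\mathcal F}(x)]_i=\ell_i$ if $x_i<\ell_i$, $u_i$ if $x_i>u_i$, and $x_i$ otherwise. Active set at $x\in\mathcal F$: $\mathcal A(x)=\{i : x_i=\ell_i\text{ or }x_i=u_i\}$. Working set at $x_k$: $\mathcal W_k=\{i : ([x_k]_i\le \ell_i+\epsilon_k \text{ and } \nabla_i f(x_k)>0)\ \text{or}\ ([x_k]_i\ge u_i-\epsilon_k \text{ and } \nabla_i f(x_k)<0)\}$. Stationary point: $x^*\in\mathcal F$ is a stationary point if $\nabla_if(x^* )=0$ for $\ell_i<x^*_i<u_i$, $\nabla_if(x^* )\ge0$ for $x^*_i=\ell_i$ and $\ell_i<u_i$, and $\nabla_if(x^* )\le0$ for $x^*_i=u_i$ and $\ell_i<u_i$. It is nondegenerate if $\nabla_if(x^* )>0$ for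 $x^*_i=\ell_i$ and $\ell_i<u_i$, and $\nabla_if(x^* )<0$ for $x^*_i=u_i$ and $\ell_i<u_i$. Quasi-Armijo step: for fixed constants $\eta_A\in(0,\tfrac12)$, $\gamma>0$, $\sigma\in(0,1)$ (independent of $k$), $\alpha_k=\gamma\sigma^{t_k}$, where $t_k$ is the smallest nonnegative integer such that $f(x_k(\alpha_k))\le f(x_k)+\alpha_k\eta_A\nabla f(x_k)^Tp_k$. Quasi-Wolfe step: for fixed constants $0<\eta_A<\eta_W<1$ and a continuous, piecewise continuously differentiable function $\varphi$ on $[0,\infty)$ whose derivative has finitely many jump discontinuities, write $\varphi'_-(\alpha)=\lim_{\beta\to\alpha^-}\varphi'(\beta)$ and $\varphi'_+(\alpha)=\lim_{\beta\to\alpha^+}\varphi'(\beta)$. A step $\alpha>0$ is a quasi-Wolfe step for $\varphi$ if (C1) $\varphi(\alpha)\le\varphi(0)+\alpha\eta_A\varphi'_+(0)$, and at least one of the following holds: (C2) $|\varphi'_-(\alpha)|\le\eta_W|\varphi'_+(0)|$; (C3) $|\varphi'_+(\alpha)|\le\eta_W|\varphi'_+(0)|$; (C4) $\varphi$ is not differentiable at $\alpha$ and $\varphi'_-(\alpha)\le0\le\varphi'_+(\alpha)$. *)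

theory Defs
  imports "HOL-Analysis.Analysis"
begin

section \<open>Gradients and continuous differentiability\<close>

definition gradient :: "('a::real_inner \<Rightarrow> real) \<Rightarrow> 'a \<Rightarrow> 'a" where
  "gradient f x = (THE D. GDERIV f x :> D)"

lemma gradient_eqI:
  assumes "GDERIV f x :> D"
  shows "gradient f x = D"
  unfolding gradient_def
proof (rule the_equality[where P = "\<lambda>D. GDERIV f x :> D", OF assms])
  fix E assume "GDERIV f x :> E"
  with assms have "(\<lambda>h. inner h E) = (\<lambda>h. inner h D)"
    unfolding gderiv_def by (rule has_derivative_unique[rotated])
  then have "inner (E - D) (E - D) = 0"
    by (metis inner_diff_right right_minus_eq)
  then show "E = D" by simp
qed

definition continuously_differentiable_near :: "('a::real_inner \<Rightarrow> real) \<Rightarrow> 'a set \<Rightarrow> bool" where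
  "continuously_differentiable_near f S \<longleftrightarrow>
     (\<exists>U. open U \<and> S \<subseteq> U \<and> (\<forall>x\<in>U. f differentiable (at x)) \<and> continuous_on U (gradient f))"


section \<open>The box and its projection\<close>

definition bounds :: "ereal ^ 'n \<Rightarrow> ereal ^ 'n \<Rightarrow> bool" where
  "bounds l u \<longleftrightarrow> (\<forall>i. l $ i \<le> u $ i \<and> l $ i \<noteq> \<infinity> \<and> u $ i \<noteq> -\<infinity>)"

definition feasible :: "ereal ^ 'n \<Rightarrow> ereal ^ 'n \<Rightarrow> (real ^ 'n) set" where
  "feasible l u = {x. \<forall>i. l $ i \<le> ereal (x $ i) \<and> ereal (x $ i) \<le> u $ i}"

text \<open>Under \<^const>\<open>bounds\<close>, \<^const>\<open>real_of_ereal\<close> is only applied to finite bounds below.\<close>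

definition proj :: "ereal ^ 'n \<Rightarrow> ereal ^ 'n \<Rightarrow> real ^ 'n \<Rightarrow> real ^ 'n" where
  "proj l u x = (\<chi> i. if ereal (x $ i) < l $ i then real_of_ereal (l $ i)
                      else if u $ i < ereal (x $ i) then real_of_ereal (u $ i)
                      else x $ i)"

definition search_arc ::
  "ereal ^ 'n \<Rightarrow> ereal ^ 'n \<Rightarrow> real ^ 'n \<Rightarrow> real ^ 'n \<Rightarrow> real \<Rightarrow> real ^ 'n" where
  "search_arc l u x p a = proj l u (x + a *\<^sub>R p)"


section \<open>Active, extended active and working sets\<close>

definition active_set :: "ereal ^ 'n \<Rightarrow> ereal ^ 'n \<Rightarrow> real ^ 'n \<Rightarrow> 'n set" where
  "active_set l u x = {i. ereal (x $ i) = l $ i \<or> ereal (x $ i) = u $ i}"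

definition extended_active_set ::
  "ereal ^ 'n \<Rightarrow> ereal ^ 'n \<Rightarrow> real \<Rightarrow> real ^ 'n \<Rightarrow> 'n set" where
  "extended_active_set l u \<epsilon> x =
     {i. ereal (x $ i) \<le> l $ i + ereal \<epsilon> \<or> ereal (x $ i) \<ge> u $ i - ereal \<epsilon>}"

definition working_set ::
  "(real ^ 'n \<Rightarrow> real) \<Rightarrow> ereal ^ 'n \<Rightarrow> ereal ^ 'n \<Rightarrow> real \<Rightarrow> real ^ 'n \<Rightarrow> 'n set" where
  "working_set f l u \<epsilon> x =
     {i. (ereal (x $ i) \<le> l $ i + ereal \<epsilon> \<and> gradient f x $ i > 0) \<or>
         (ereal (x $ i) \<ge> u $ i - ereal \<epsilon> \<and> gradient f x $ i < 0)}"

definition projected_directions :: "'n set \<Rightarrow> (real ^ 'n) set" where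
  "projected_directions W = {d. \<forall>i\<in>W. d $ i = 0}"


section \<open>Stationary points\<close>

definition stationary_point ::
  "(real ^ 'n \<Rightarrow> real) \<Rightarrow> ereal ^ 'n \<Rightarrow> ereal ^ 'n \<Rightarrow> real ^ 'n \<Rightarrow> bool" where
  "stationary_point f l u x \<longleftrightarrow> x \<in> feasible l u \<and>
     (\<forall>i. (l $ i < ereal (x $ i) \<and> ereal (x $ i) < u $ i \<longrightarrow> gradient f x $ i = 0) \<and>
          (ereal (x $ i) = l $ i \<and> l $ i < u $ i \<longrightarrow> gradient f x $ i \<ge> 0) \<and>
          (ereal (x $ i) = u $ i \<and> l $ i < u $ i \<longrightarrow> gradient f x $ i \<le> 0))"

definition nondegenerate_stationary_point ::
  "(real ^ 'n \<Rightarrow> real) \<Rightarrow> ereal ^ 'n \<Rightarrow> ereal ^ 'n \<Rightarrow> real ^ 'n \<Rightarrow> bool" where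
  "nondegenerate_stationary_point f l u x \<longleftrightarrow> stationary_point f l u x \<and>
     (\<forall>i. (ereal (x $ i) = l $ i \<and> l $ i < u $ i \<longrightarrow> gradient f x $ i > 0) \<and>
          (ereal (x $ i) = u $ i \<and> l $ i < u $ i \<longrightarrow> gradient f x $ i < 0))"


section \<open>Matrices with a varying number of columns\<close>

text \<open>
  The number of columns of \<open>\<Pi>\<^sub>k\<close> depends on \<open>k\<close>, so a matrix with \<open>n\<close> rows is given by the list
  of its columns, and vectors of column-indexed coefficients are lists as well.
\<close>

definition mat_vec :: "(real ^ 'n) list \<Rightarrow> real list \<Rightarrow> real ^ 'n" where
  "mat_vec Q y = (\<Sum>j<length Q. (y ! j) *\<^sub>R (Q ! j))"

definition mat_transpose_vec :: "(real ^ 'n) list \<Rightarrow> real ^ 'n \<Rightarrow> real list" where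
  "mat_transpose_vec Q v = map (\<lambda>q. q \<bullet> v) Q"

definition list_norm :: "real list \<Rightarrow> real" where
  "list_norm y = L2_set (\<lambda>j. y ! j) {..<length y}"

definition orthonormal_columns :: "(real ^ 'n) list \<Rightarrow> bool" where
  "orthonormal_columns Q \<longleftrightarrow>
     (\<forall>i<length Q. \<forall>j<length Q. Q ! i \<bullet> Q ! j = (if i = j then 1 else 0))"


section \<open>Quasi-Armijo and quasi-Wolfe steps\<close>

definition quasi_armijo_step ::
  "real \<Rightarrow> real \<Rightarrow> real \<Rightarrow> (real ^ 'n \<Rightarrow> real) \<Rightarrow> ereal ^ 'n \<Rightarrow> ereal ^ 'n \<Rightarrow>
    real ^ 'n \<Rightarrow> real ^ 'n \<Rightarrow> real \<Rightarrow> bool" where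
  "quasi_armijo_step \<eta>A \<gamma> \<sigma> f l u x p \<alpha> \<longleftrightarrow>
     (let ok = (\<lambda>t::nat. f (search_arc l u x p (\<gamma> * \<sigma> ^ t))
                  \<le> f x + (\<gamma> * \<sigma> ^ t) * \<eta>A * (gradient f x \<bullet> p))
      in \<exists>t. \<alpha> = \<gamma> * \<sigma> ^ t \<and> ok t \<and> (\<forall>s<t. \<not> ok s))"

definition left_deriv_limit :: "(real \<Rightarrow> real) \<Rightarrow> real \<Rightarrow> real" where
  "left_deriv_limit \<phi> a = Lim (at_left a) (deriv \<phi>)"

definition right_deriv_limit :: "(real \<Rightarrow> real) \<Rightarrow> real \<Rightarrow> real" where
  "right_deriv_limit \<phi> a = Lim (at_right a) (deriv \<phi>)"

text \<open>
  Continuous and piecewise \<open>C\<^sup>1\<close> on \<open>[0, \<infinity>)\<close>, where the finitely many discontinuities of the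
  derivative are jumps: all one-sided limits of the derivative exist and are finite. Every
  \<open>\<lambda>a. f (search_arc l u x p a)\<close> with \<open>f\<close> being \<open>C\<^sup>1\<close> near the box and \<open>x\<close> in the box has this
  property, since the path is piecewise linear with at most one break point per component.
\<close>

definition piecewise_C1_with_jumps :: "(real \<Rightarrow> real) \<Rightarrow> bool" where
  "piecewise_C1_with_jumps \<phi> \<longleftrightarrow>
     \<phi> piecewise_C1_differentiable_on {0..} \<and>
     (\<forall>a\<ge>0. \<exists>L. (deriv \<phi> \<longlongrightarrow> L) (at_right a)) \<and>
     (\<forall>a>0. \<exists>L. (deriv \<phi> \<longlongrightarrow> L) (at_left a))"

definition quasi_wolfe_step :: "real \<Rightarrow> real \<Rightarrow> (real \<Rightarrow> real) \<Rightarrow> real \<Rightarrow> bool" where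
  "quasi_wolfe_step \<eta>A \<eta>W \<phi> \<alpha> \<longleftrightarrow>
     piecewise_C1_with_jumps \<phi> \<and> \<alpha> > 0 \<and>
     \<phi> \<alpha> \<le> \<phi> 0 + \<alpha> * \<eta>A * right_deriv_limit \<phi> 0 \<and>
     (\<bar>left_deriv_limit \<phi> \<alpha>\<bar> \<le> \<eta>W * \<bar>right_deriv_limit \<phi> 0\<bar> \<or>
      \<bar>right_deriv_limit \<phi> \<alpha>\<bar> \<le> \<eta>W * \<bar>right_deriv_limit \<phi> 0\<bar> \<or>
      (\<not> \<phi> differentiable (at \<alpha>) \<and>
       left_deriv_limit \<phi> \<alpha> \<le> 0 \<and> 0 \<le> right_deriv_limit \<phi> \<alpha>))"

end

theory Submission
  imports Defs
begin

text \<open>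
  Where \<open>\<nabla>\<^sub>i f(x\<^sup>*) \<noteq> 0\<close>, the component \<open>\<nabla>\<^sub>i f(x\<^sub>k)\<close> stays away from zero,
  so \<open>\<parallel>\<Pi>\<^sub>k\<^sup>T \<nabla>f(x\<^sub>k)\<parallel> \<rightarrow> 0\<close> is only possible if \<open>i\<close> eventually belongs to the working
  set: otherwise the \<open>i\<close>th unit vector lies in the column span of \<open>\<Pi>\<^sub>k\<close> and
  \<open>\<bar>\<nabla>\<^sub>i f(x\<^sub>k)\<bar> \<le> \<parallel>\<Pi>\<^sub>k\<^sup>T \<nabla>f(x\<^sub>k)\<parallel>\<close>. From then on \<open>[p\<^sub>k]\<^sub>i = 0\<close>, so \<open>[x\<^sub>k]\<^sub>i\<close> is eventually
  constant and equal to its limit \<open>x\<^sup>*\<^sub>i\<close>. By nondegeneracy this applies to every active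
  component with \<open>\<ell>\<^sub>i < u\<^sub>i\<close>, whereas an inactive component is eventually farther
  than \<open>\<epsilon>\<^sub>k \<rightarrow> 0\<close> from both of its bounds.
\<close>

lemma mat_vec_in_span: "mat_vec Q y \<in> span (set Q)"
  unfolding mat_vec_def by (intro span_sum span_scale span_base) auto

lemma mat_transpose_vec_nth [simp]:
  "j < length Q \<Longrightarrow> mat_transpose_vec Q v ! j = Q ! j \<bullet> v"
  by (simp add: mat_transpose_vec_def)

lemma length_mat_transpose_vec [simp]: "length (mat_transpose_vec Q v) = length Q"
  by (simp add: mat_transpose_vec_def)

lemma list_norm_nonneg: "0 \<le> list_norm y"
  by (simp add: list_norm_def)

lemma list_norm_mat_transpose_vec:
  "list_norm (mat_transpose_vec Q v) = L2_set (\<lambda>j. Q ! j \<bullet> v) {..<length Q}"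
  by (auto simp: list_norm_def intro!: L2_set_cong)

text \<open>For orthonormal columns, \<open>Q Q^T\<close> is the orthogonal projector onto their
  span. It fixes each column by orthonormality, and linearity carries this to the span by
  induction.\<close>

lemma mat_vec_mat_transpose_vec:
  assumes "orthonormal_columns Q" and "w \<in> span (set Q)"
  shows "mat_vec Q (mat_transpose_vec Q w) = w"
proof -
  have eq: "mat_vec Q (mat_transpose_vec Q v) = (\<Sum>j<length Q. (Q ! j \<bullet> v) *\<^sub>R Q ! j)" for v
    by (simp add: mat_vec_def)
  have "(\<Sum>j<length Q. (Q ! j \<bullet> w) *\<^sub>R Q ! j) = w"
    using assms(2)
  proof (induction rule: span_induct_alt)
    case base
    show ?case by simp
  next
    case (step c q v)
    then obtain i where i: "i < length Q" "q = Q ! i"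
      by (auto simp: in_set_conv_nth)
    have "(\<Sum>j<length Q. (Q ! j \<bullet> q) *\<^sub>R Q ! j) = (\<Sum>j<length Q. if j = i then Q ! j else 0)"
      using assms(1) i by (intro sum.cong) (auto simp: orthonormal_columns_def)
    also have "\<dots> = q"
      using i by simp
    finally have "c *\<^sub>R (\<Sum>j<length Q. (Q ! j \<bullet> q) *\<^sub>R Q ! j) = c *\<^sub>R q"
      by (rule arg_cong)
    then have "(\<Sum>j<length Q. (c * (Q ! j \<bullet> q)) *\<^sub>R Q ! j) = c *\<^sub>R q"
      by (simp only: scaleR_sum_right scaleR_scaleR)
    then show ?case
      using step.IH by (simp add: inner_add_right scaleR_add_left sum.distrib)
  qed
  then show ?thesis by (simp only: eq)
qed

lemma inner_mat_vec: "mat_vec Q y \<bullet> v = (\<Sum>j<length Q. y ! j * (Q ! j \<bullet> v))"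
  by (simp add: mat_vec_def inner_sum_left)

text \<open>Parseval's identity: expand one factor of \<open>w \<bullet> w\<close> in the columns of
  \<open>Q\<close>.\<close>

lemma list_norm_mat_transpose_vec_span:
  assumes "orthonormal_columns Q" and "w \<in> span (set Q)"
  shows "list_norm (mat_transpose_vec Q w) = norm w"
proof -
  have "w \<bullet> w = (\<Sum>j<length Q. (Q ! j \<bullet> w)\<^sup>2)"
    using inner_mat_vec[of Q "mat_transpose_vec Q w" w]
    by (simp add: mat_vec_mat_transpose_vec[OF assms] power2_eq_square)
  then show ?thesis
    by (simp add: list_norm_mat_transpose_vec L2_set_def norm_eq_sqrt_inner)
qed

text \<open>As \<open>w = Q (Q^T w)\<close>, the inner product with \<open>v\<close> is that of the
  coefficient lists \<open>Q^T w\<close> and \<open>Q^T v\<close>. Cauchy-Schwarz applies to these,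
  and \<open>Q^T\<close> preserves the norm of \<open>w\<close>.\<close>

lemma abs_inner_le_list_norm_mat_transpose_vec:
  assumes "orthonormal_columns Q" and "w \<in> span (set Q)"
  shows "\<bar>w \<bullet> v\<bar> \<le> norm w * list_norm (mat_transpose_vec Q v)"
proof -
  have "w \<bullet> v = (\<Sum>j<length Q. (Q ! j \<bullet> w) * (Q ! j \<bullet> v))"
    using inner_mat_vec[of Q "mat_transpose_vec Q w" v]
    by (simp add: mat_vec_mat_transpose_vec[OF assms])
  then have "\<bar>w \<bullet> v\<bar> \<le> (\<Sum>j<length Q. \<bar>Q ! j \<bullet> w\<bar> * \<bar>Q ! j \<bullet> v\<bar>)"
    by (simp flip: abs_mult)
  also have "\<dots> \<le> L2_set (\<lambda>j. Q ! j \<bullet> w) {..<length Q} * L2_set (\<lambda>j. Q ! j \<bullet> v) {..<length Q}"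
    by (rule L2_set_mult_ineq)
  finally show ?thesis
    using list_norm_mat_transpose_vec_span[OF assms] by (simp add: list_norm_mat_transpose_vec)
qed

lemma component_le_list_norm_mat_transpose_vec:
  assumes "orthonormal_columns Q" and "span (set Q) = projected_directions W" and "i \<notin> W"
  shows "\<bar>v $ i\<bar> \<le> list_norm (mat_transpose_vec Q v)"
proof -
  have "axis i 1 \<in> span (set Q)"
    using assms(2,3) by (auto simp: projected_directions_def axis_def)
  from abs_inner_le_list_norm_mat_transpose_vec[OF assms(1) this, of v]
  show ?thesis by (simp add: inner_axis')
qed

lemma proj_in_feasible:
  assumes "bounds l u"
  shows "proj l u y \<in> feasible l u"
proof -
  have "l $ i \<le> ereal (proj l u y $ i) \<and> ereal (proj l u y $ i) \<le> u $ i" for i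
    using assms unfolding bounds_def proj_def
    \<comment> \<open>A branch of \<open>proj\<close> that returns a bound is entered only if that
      bound is finite, because \<open>bounds\<close> rules out a lower bound \<infinity> and an
      upper bound -\<infinity>.\<close>
    by (cases "l $ i"; cases "u $ i") (auto dest!: spec[of _ i])
  then show ?thesis by (simp add: feasible_def)
qed

lemma search_arc_component_fixed:
  assumes "y \<in> feasible l u" and "p $ i = 0"
  shows "search_arc l u y p a $ i = y $ i"
  using assms by (auto simp: search_arc_def proj_def feasible_def dest!: spec[of _ i])

lemma active_set_subset_extended_active_set:
  assumes "0 \<le> \<epsilon>"
  shows "active_set l u y \<subseteq> extended_active_set l u \<epsilon> y"
proof
  fix i assume "i \<in> active_set l u y"
  with assms show "i \<in> extended_active_set l u \<epsilon> y"
    by (cases "l $ i"; cases "u $ i") (auto simp: active_set_def extended_active_set_def)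
qed

text \<open>The open set around \<open>S\<close> makes the gradient continuous at \<open>z\<close>
  even when \<open>z\<close> is a boundary point of \<open>S\<close>.\<close>

lemma tendsto_gradient:
  assumes "continuously_differentiable_near f S" and "z \<in> S" and "x \<longlonglongrightarrow> z"
  shows "(\<lambda>k. gradient f (x k)) \<longlonglongrightarrow> gradient f z"
proof -
  obtain U where "open U" "S \<subseteq> U" "continuous_on U (gradient f)"
    using assms(1) by (auto simp: continuously_differentiable_near_def)
  with assms(2) have "isCont (gradient f) z"
    by (auto simp: continuous_on_eq_continuous_at)
  then show ?thesis
    using assms(3) by (rule isCont_tendsto_compose)
qed

lemma eventually_not_in_extended_active_set:
  assumes "z \<in> feasible l u" and "i \<notin> active_set l u z" and "x \<longlonglongrightarrow> z" and "e \<longlonglongrightarrow> 0"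
  shows "\<forall>\<^sub>F k in sequentially. i \<notin> extended_active_set l u (e k) (x k)"
proof -
  have less: "l $ i < ereal (z $ i)" "ereal (z $ i) < u $ i"
    using assms(1,2) by (auto simp: feasible_def active_set_def order.strict_iff_order)
  have xi: "(\<lambda>k. x k $ i) \<longlonglongrightarrow> z $ i"
    using assms(3) by (rule tendsto_vec_nth)
  have "\<forall>\<^sub>F k in sequentially. l $ i + ereal (e k) < ereal (x k $ i)"
  proof (cases "l $ i")
    case (real r)
    \<comment> \<open>With \<open>e k\<close> moved to the side of the iterate, a finite bound is
      compared with a convergent real sequence whose limit lies strictly beyond it.\<close>
    have "(\<lambda>k. x k $ i - e k) \<longlonglongrightarrow> z $ i"
      using tendsto_diff[OF xi assms(4)] by simp
    from order_tendstoD(1)[OF this, of r] show ?thesis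
      using less real by (auto elim!: eventually_mono)
  qed (use less in auto)
  moreover have "\<forall>\<^sub>F k in sequentially. ereal (x k $ i) < u $ i - ereal (e k)"
  proof (cases "u $ i")
    case (real r)
    have "(\<lambda>k. x k $ i + e k) \<longlonglongrightarrow> z $ i"
      using tendsto_add[OF xi assms(4)] by simp
    from order_tendstoD(2)[OF this, of r] show ?thesis
      using less real by (auto elim!: eventually_mono)
  qed (use less in auto)
  ultimately show ?thesis
    by eventually_elim (auto simp: extended_active_set_def not_le)
qed

lemma eventually_eq_limit_of_eventually_stationary:
  fixes s :: "nat \<Rightarrow> 'a::t2_space"
  assumes "\<forall>\<^sub>F k in sequentially. s (Suc k) = s k" and "s \<longlonglongrightarrow> a"
  shows "\<forall>\<^sub>F k in sequentially. s k = a"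
proof -
  obtain N where N: "\<And>k. k \<ge> N \<Longrightarrow> s (Suc k) = s k"
    using assms(1) by (auto simp: eventually_sequentially)
  have const: "s k = s N" if "k \<ge> N" for k
    using that by (induction k rule: dec_induct) (auto simp: N)
  have ev: "\<forall>\<^sub>F k in sequentially. s k = s N"
    using eventually_ge_at_top[of N] by (rule eventually_mono) (rule const)
  then have "s \<longlonglongrightarrow> s N"
    by (rule tendsto_eventually)
  with assms(2) have "s N = a"
    by (rule LIMSEQ_unique[rotated])
  with ev show ?thesis by simp
qed

theorem theorem5p3:
  fixes f :: "real ^ 'n \<Rightarrow> real"
    and l u :: "ereal ^ 'n"
    and x p :: "nat \<Rightarrow> real ^ 'n"
    and \<alpha> \<epsilon>s :: "nat \<Rightarrow> real"
    and \<epsilon> \<theta> :: real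
    and PI :: "nat \<Rightarrow> (real ^ 'n) list"
    and xstar :: "real ^ 'n"
  assumes bnds: "bounds l u"
    and C1: "continuously_differentiable_near f (feasible l u)"
    and x0: "x 0 \<in> feasible l u"
    and level_bounded: "bounded {y \<in> feasible l u. f y \<le> f (x 0)}"
    and iterates: "\<And>k. x (Suc k) = search_arc l u (x k) (p k) (\<alpha> k)"
    and steps:
      "(\<exists>\<eta>A \<gamma> \<sigma>. 0 < \<eta>A \<and> \<eta>A < 1/2 \<and> 0 < \<gamma> \<and> 0 < \<sigma> \<and> \<sigma> < 1 \<and>
          (\<forall>k. quasi_armijo_step \<eta>A \<gamma> \<sigma> f l u (x k) (p k) (\<alpha> k))) \<or>
       (\<exists>\<eta>A \<eta>W. 0 < \<eta>A \<and> \<eta>A < \<eta>W \<and> \<eta>W < 1 \<and>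
          (\<forall>k. quasi_wolfe_step \<eta>A \<eta>W (\<lambda>a. f (search_arc l u (x k) (p k) a)) (\<alpha> k)))"
    and eps_pos: "\<epsilon> > 0"
    and eps_0: "\<epsilon>s 0 = \<epsilon>"
    and eps_Suc: "\<And>k. \<epsilon>s (Suc k) = min \<epsilon> (list_norm (mat_transpose_vec (PI k) (gradient f (x k))))"
    and Pi_orthonormal: "\<And>k. orthonormal_columns (PI k)"
    and Pi_span: "\<And>k. span (set (PI k)) = projected_directions (working_set f l u (\<epsilon>s k) (x k))"
    and descent: "\<And>k. gradient f (x k) \<bullet> p k < 0"
    and p_bounded: "\<And>k. norm (p k) \<le> \<theta>"
    and p_projected: "\<And>k. mat_vec (PI k) (mat_transpose_vec (PI k) (p k)) = p k"
    and p_lower: "\<And>k i. ereal (x k $ i) \<le> l $ i + ereal (\<epsilon>s k) \<Longrightarrow> p k $ i \<ge> 0"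
    and p_upper: "\<And>k i. ereal (x k $ i) \<ge> u $ i - ereal (\<epsilon>s k) \<Longrightarrow> p k $ i \<le> 0"
    and converges: "x \<longlonglongrightarrow> xstar"
    and nondegenerate: "nondegenerate_stationary_point f l u xstar"
    and proj_grad: "(\<lambda>k. list_norm (mat_transpose_vec (PI k) (gradient f (x k)))) \<longlonglongrightarrow> 0"
  shows "\<forall>\<^sub>F k in sequentially.
           extended_active_set l u (\<epsilon>s k) (x k) = active_set l u (x k) \<and>
           active_set l u (x k) = active_set l u xstar"
proof -
  have feas: "x k \<in> feasible l u" for k
    by (cases k) (simp_all add: x0 iterates search_arc_def proj_in_feasible[OF bnds])
  have star: "xstar \<in> feasible l u"
    using nondegenerate by (simp add: nondegenerate_stationary_point_def stationary_point_def)
  have eps_nonneg: "0 \<le> \<epsilon>s k" for k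
    using eps_pos by (cases k) (simp_all add: eps_0 eps_Suc list_norm_nonneg)
  \<comment> \<open>The recursion describes only the shifted sequence. Its limit is
    \<open>min \<epsilon> 0\<close>, which is 0 as \<epsilon> is positive.\<close>
  have "(\<lambda>k. \<epsilon>s (Suc k)) \<longlonglongrightarrow> 0"
    unfolding eps_Suc using tendsto_min[OF tendsto_const proj_grad, of \<epsilon>] eps_pos by simp
  then have eps_lim: "\<epsilon>s \<longlonglongrightarrow> 0"
    by (simp only: filterlim_sequentially_Suc)

  have fixed: "\<forall>\<^sub>F k in sequentially. x k $ i = xstar $ i" if "gradient f xstar $ i \<noteq> 0" for i
  proof -
    have "(\<lambda>k. \<bar>gradient f (x k) $ i\<bar> - list_norm (mat_transpose_vec (PI k) (gradient f (x k))))
        \<longlonglongrightarrow> \<bar>gradient f xstar $ i\<bar> - 0"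
      by (intro tendsto_intros tendsto_gradient[OF C1 star converges] proj_grad)
    then have "\<forall>\<^sub>F k in sequentially.
        0 < \<bar>gradient f (x k) $ i\<bar> - list_norm (mat_transpose_vec (PI k) (gradient f (x k)))"
      by (rule order_tendstoD(1)) (use that in simp)
    then have "\<forall>\<^sub>F k in sequentially. x (Suc k) $ i = x k $ i"
    proof eventually_elim
      case (elim k)
      then have "i \<in> working_set f l u (\<epsilon>s k) (x k)"
        using component_le_list_norm_mat_transpose_vec[OF Pi_orthonormal Pi_span,
            of i k "gradient f (x k)"] by force
      \<comment> \<open>Being the image of a coefficient list under \<open>PI k\<close>, the
        direction lies in the column span.\<close>
      moreover have "p k \<in> projected_directions (working_set f l u (\<epsilon>s k) (x k))"
        using mat_vec_in_span p_projected Pi_span by metis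
      ultimately have "p k $ i = 0"
        by (simp add: projected_directions_def)
      then show ?case
        by (simp add: iterates search_arc_component_fixed[OF feas])
    qed
    then show ?thesis
      by (rule eventually_eq_limit_of_eventually_stationary)
        (rule tendsto_vec_nth[OF converges])
  qed

  have active: "\<forall>\<^sub>F k in sequentially. i \<in> active_set l u (x k)"
    if i: "i \<in> active_set l u xstar" for i
  proof (cases "l $ i < u $ i")
    case True
    with i nondegenerate have "gradient f xstar $ i \<noteq> 0"
      unfolding nondegenerate_stationary_point_def active_set_def by force
    from fixed[OF this] show ?thesis
      by eventually_elim (use i in \<open>simp add: active_set_def\<close>)
  next
    case False
    \<comment> \<open>Here both bounds coincide. Nondegeneracy gives no sign of the gradient, but
      feasibility pins the component to the common bound.\<close>
    have "i \<in> active_set l u (x k)" for k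
      using feas[of k] False by (force simp: feasible_def active_set_def dest!: spec[of _ i])
    then show ?thesis by simp
  qed
  \<comment> \<open>Each index has its own threshold; a common one exists because the index type is
    finite.\<close>
  have "\<forall>\<^sub>F k in sequentially.
      (i \<in> extended_active_set l u (\<epsilon>s k) (x k) \<longleftrightarrow> i \<in> active_set l u (x k)) \<and>
      (i \<in> active_set l u (x k) \<longleftrightarrow> i \<in> active_set l u xstar)" for i
  proof (cases "i \<in> active_set l u xstar")
    case True
    from active[OF this] show ?thesis
      by eventually_elim
        (use True active_set_subset_extended_active_set[OF eps_nonneg] in blast)
  next
    case False
    \<comment> \<open>Leaving the larger extended set also excludes the index from the active set at
      \<open>x k\<close>.\<close>
    from eventually_not_in_extended_active_set[OF star this converges eps_lim] show ?thesis
      by eventually_elim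
        (use False active_set_subset_extended_active_set[OF eps_nonneg] in blast)
  qed
  then have "\<forall>\<^sub>F k in sequentially. \<forall>i.
      (i \<in> extended_active_set l u (\<epsilon>s k) (x k) \<longleftrightarrow> i \<in> active_set l u (x k)) \<and>
      (i \<in> active_set l u (x k) \<longleftrightarrow> i \<in> active_set l u xstar)"
    by (rule eventually_all_finite)
  then show ?thesis
    by eventually_elim blast
qed

end
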